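(* Let $(M,J,g)$ be a metallic-like pseudo-Riemannian manifold, with associated tensor field $J^{\ast}$, and let $\nabla$ be a torsion-free linear connection on $M$. If $\nabla J=0$, $\nabla J^{\ast}=0$ and $(\nabla,g)$ is Codazzi-coupled, then $$(\Phi_{J^{\ast}}g)(X,Y,Z)+(\Phi_Jg)(X,Y,Z)=0$$ for all vector fields $X,Y,Z$ on $M$.
   Context: $X,Y,Z$ denote arbitrary smooth vector fields on $M$. A metallic structure on a smooth manifold $M$ is a $(1,1)$-tensor field $J$, which is a bundle isomorphism $TM\to TM$, such that $J^2=pJ+qI$ for some real numbers $p,q$ ($I$ the identity). A metallic-like pseudo-Riemannian manifold $(M,J,g)$ is a pseudo-Riemannian manifold $(M,g)$ with a metallic structure $J$ (not assumed $g$-symmetric) together with the $(1,1)$-tensor field $J^{\ast}$ satisfying $g(JX,Y)=g(X,J^{\ast}Y)$ (so $(J^{\ast})^{\ast}=J$). The pair $(\nabla,g)$ is Codazzi-coupled if $(\nabla_Xg)(Y,Z)=(\nabla_Zg)(X,Y)$ for all $X,Y,Z$. For a $(1,1)$-tensor field $K$, the expression $\Phi_Kg$ is defined on vector fields by $$(\Phi_Kg)(X,Y,Z)=(KX)\big(g(Y,Z)\big)-X\big(g(KY,Z)\big)+g\big((L_YK)X,Z\big)+g\big(Y,(L_ZK)X\big),$$ where $(L_XK)Y=[X,KY]-K[X,Y]$. *)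

theory Defs
  imports "HOL-Analysis.Analysis" "HOL-Library.Function_Algebras"
begin

section \<open>Smooth manifolds and smooth functions\<close>

text \<open>
  In finite dimension, being \<open>C\<^sup>k\<^sup>+\<^sup>1\<close> on an open set is the same as being differentiable with all
  directional derivatives \<open>C\<^sup>k\<close>.  The predicate is only meant for open \<open>S\<close>.
\<close>

primrec C_k_on :: "nat \<Rightarrow> ('e::real_normed_vector \<Rightarrow> 'f::real_normed_vector) \<Rightarrow> 'e set \<Rightarrow> bool" where
  "C_k_on 0 f S \<longleftrightarrow> continuous_on S f"
| "C_k_on (Suc k) f S \<longleftrightarrow>
     (\<forall>x\<in>S. f differentiable (at x)) \<and> (\<forall>v. C_k_on k (\<lambda>x. frechet_derivative f (at x) v) S)"

definition C_infinity_on :: "('e::real_normed_vector \<Rightarrow> 'f::real_normed_vector) \<Rightarrow> 'e set \<Rightarrow> bool" where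
  "C_infinity_on f S \<longleftrightarrow> (\<forall>k. C_k_on k f S)"

type_synonym ('m, 'e) atlas = "('m set \<times> ('m \<Rightarrow> 'e)) set"

text \<open>
  The manifold is the whole type \<open>'m\<close>, Hausdorff and second countable by its type classes.  Charts take
  values in a finite-dimensional normed space \<open>'e\<close>; class \<open>euclidean_space\<close> would exclude dimension 0.
  The atlas need not be maximal: an atlas and its maximal extension have the same smooth functions.
\<close>

definition smooth_manifold ::
    "('m::{t2_space,second_countable_topology}, 'e::real_normed_vector) atlas \<Rightarrow> bool" where
  "smooth_manifold A \<longleftrightarrow>
     (\<exists>B::'e set. finite B \<and> span B = UNIV) \<and>
     (\<Union>(U, \<phi>)\<in>A. U) = UNIV \<and>
     (\<forall>(U, \<phi>)\<in>A. open U \<and> open (\<phi> ` U) \<and> homeomorphism U (\<phi> ` U) \<phi> (inv_into U \<phi>)) \<and>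
     (\<forall>(U, \<phi>)\<in>A. \<forall>(V, \<psi>)\<in>A. C_infinity_on (\<psi> \<circ> inv_into U \<phi>) (\<phi> ` (U \<inter> V)))"

definition smooth_functions ::
    "('m::{t2_space,second_countable_topology}, 'e::real_normed_vector) atlas \<Rightarrow> ('m \<Rightarrow> real) set" where
  "smooth_functions A = {f. \<forall>(U, \<phi>)\<in>A. C_infinity_on (f \<circ> inv_into U \<phi>) (\<phi> ` U)}"

section \<open>Tangent vectors, vector fields and tensor fields\<close>

text \<open>
  Tangent vectors at \<open>x\<close> are the derivations at \<open>x\<close> of the algebra of smooth functions.  As HOL functions
  are total, they are given the value 0 on non-smooth functions, so that equality of tangent vectors
  is equality on smooth functions.  Addition and zero are those of \<open>Function_Algebras\<close>, i.e. pointwise.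
\<close>

type_synonym 'm tvec = "('m \<Rightarrow> real) \<Rightarrow> real"
type_synonym 'm vfield = "'m \<Rightarrow> 'm tvec"
type_synonym 'm endo_field = "'m \<Rightarrow> 'm tvec \<Rightarrow> 'm tvec"
type_synonym 'm bilin_field = "'m \<Rightarrow> 'm tvec \<Rightarrow> 'm tvec \<Rightarrow> real"
type_synonym 'm connection = "'m vfield \<Rightarrow> 'm vfield \<Rightarrow> 'm vfield"

definition tscale :: "real \<Rightarrow> 'm tvec \<Rightarrow> 'm tvec" where
  "tscale c v = (\<lambda>f. c * v f)"

definition tangent_space ::
    "('m::{t2_space,second_countable_topology}, 'e::real_normed_vector) atlas \<Rightarrow> 'm \<Rightarrow> 'm tvec set" where
  "tangent_space A x = {v.
     (\<forall>f\<in>smooth_functions A. \<forall>h\<in>smooth_functions A. v (f + h) = v f + v h) \<and>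
     (\<forall>c. \<forall>f\<in>smooth_functions A. v (\<lambda>y. c * f y) = c * v f) \<and>
     (\<forall>f\<in>smooth_functions A. \<forall>h\<in>smooth_functions A. v (f * h) = f x * v h + h x * v f) \<and>
     (\<forall>f. f \<notin> smooth_functions A \<longrightarrow> v f = 0)}"

definition vderiv :: "'m vfield \<Rightarrow> ('m \<Rightarrow> real) \<Rightarrow> 'm \<Rightarrow> real" where
  "vderiv X f = (\<lambda>x. X x f)"

definition vector_fields ::
    "('m::{t2_space,second_countable_topology}, 'e::real_normed_vector) atlas \<Rightarrow> 'm vfield set" where
  "vector_fields A = {X. (\<forall>x. X x \<in> tangent_space A x) \<and>
     (\<forall>f\<in>smooth_functions A. vderiv X f \<in> smooth_functions A)}"

definition fscale :: "('m \<Rightarrow> real) \<Rightarrow> 'm vfield \<Rightarrow> 'm vfield" where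
  "fscale f X = (\<lambda>x. tscale (f x) (X x))"

definition lie_bracket :: "'m vfield \<Rightarrow> 'm vfield \<Rightarrow> 'm vfield" where
  "lie_bracket X Y = (\<lambda>x f. X x (vderiv Y f) - Y x (vderiv X f))"

definition eapply :: "'m endo_field \<Rightarrow> 'm vfield \<Rightarrow> 'm vfield" where
  "eapply K X = (\<lambda>x. K x (X x))"

definition bapply :: "'m bilin_field \<Rightarrow> 'm vfield \<Rightarrow> 'm vfield \<Rightarrow> 'm \<Rightarrow> real" where
  "bapply g X Y = (\<lambda>x. g x (X x) (Y x))"

text \<open>
  Tensor fields are families of (multi)linear maps on the tangent spaces that are smooth, i.e.
  send smooth vector fields to smooth objects.  Values outside the tangent spaces are irrelevant.
\<close>

definition tensor_field_1_1 ::
    "('m::{t2_space,second_countable_topology}, 'e::real_normed_vector) atlas \<Rightarrow> 'm endo_field \<Rightarrow> bool" where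
  "tensor_field_1_1 A K \<longleftrightarrow>
     (\<forall>x. \<forall>u\<in>tangent_space A x. K x u \<in> tangent_space A x) \<and>
     (\<forall>x. \<forall>u\<in>tangent_space A x. \<forall>v\<in>tangent_space A x. K x (u + v) = K x u + K x v) \<and>
     (\<forall>x c. \<forall>u\<in>tangent_space A x. K x (tscale c u) = tscale c (K x u)) \<and>
     (\<forall>X\<in>vector_fields A. eapply K X \<in> vector_fields A)"

definition tensor_field_0_2 ::
    "('m::{t2_space,second_countable_topology}, 'e::real_normed_vector) atlas \<Rightarrow> 'm bilin_field \<Rightarrow> bool" where
  "tensor_field_0_2 A g \<longleftrightarrow>
     (\<forall>x. \<forall>u\<in>tangent_space A x. \<forall>v\<in>tangent_space A x. \<forall>w\<in>tangent_space A x.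
        g x (u + v) w = g x u w + g x v w \<and> g x w (u + v) = g x w u + g x w v) \<and>
     (\<forall>x c. \<forall>u\<in>tangent_space A x. \<forall>v\<in>tangent_space A x.
        g x (tscale c u) v = c * g x u v \<and> g x u (tscale c v) = c * g x u v) \<and>
     (\<forall>X\<in>vector_fields A. \<forall>Y\<in>vector_fields A. bapply g X Y \<in> smooth_functions A)"

definition bundle_isomorphism ::
    "('m::{t2_space,second_countable_topology}, 'e::real_normed_vector) atlas \<Rightarrow> 'm endo_field \<Rightarrow> bool" where
  "bundle_isomorphism A K \<longleftrightarrow> tensor_field_1_1 A K \<and>
     (\<exists>L. tensor_field_1_1 A L \<and>
        (\<forall>x. \<forall>u\<in>tangent_space A x. L x (K x u) = u \<and> K x (L x u) = u))"

section \<open>Metallic-like pseudo-Riemannian manifolds\<close>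

text \<open>No constancy of the index is required; it is automatic on connected manifolds.\<close>

definition pseudo_Riemannian_metric ::
    "('m::{t2_space,second_countable_topology}, 'e::real_normed_vector) atlas \<Rightarrow> 'm bilin_field \<Rightarrow> bool" where
  "pseudo_Riemannian_metric A g \<longleftrightarrow> tensor_field_0_2 A g \<and>
     (\<forall>x. \<forall>u\<in>tangent_space A x. \<forall>v\<in>tangent_space A x. g x u v = g x v u) \<and>
     (\<forall>x. \<forall>u\<in>tangent_space A x. (\<forall>v\<in>tangent_space A x. g x u v = 0) \<longrightarrow> u = 0)"

definition metallic_structure ::
    "('m::{t2_space,second_countable_topology}, 'e::real_normed_vector) atlas \<Rightarrow> 'm endo_field \<Rightarrow> bool" where
  "metallic_structure A J \<longleftrightarrow> bundle_isomorphism A J \<and>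
     (\<exists>p q::real. \<forall>x. \<forall>u\<in>tangent_space A x. J x (J x u) = tscale p (J x u) + tscale q u)"

definition metallic_like_pseudo_Riemannian_manifold ::
    "('m::{t2_space,second_countable_topology}, 'e::real_normed_vector) atlas
      \<Rightarrow> 'm endo_field \<Rightarrow> 'm endo_field \<Rightarrow> 'm bilin_field \<Rightarrow> bool" where
  "metallic_like_pseudo_Riemannian_manifold A J Js g \<longleftrightarrow>
     smooth_manifold A \<and> pseudo_Riemannian_metric A g \<and> metallic_structure A J \<and>
     tensor_field_1_1 A Js \<and>
     (\<forall>X\<in>vector_fields A. \<forall>Y\<in>vector_fields A.
        bapply g (eapply J X) Y = bapply g X (eapply Js Y))"

section \<open>Linear connections\<close>

definition linear_connection ::
    "('m::{t2_space,second_countable_topology}, 'e::real_normed_vector) atlas \<Rightarrow> 'm connection \<Rightarrow> bool" where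
  "linear_connection A D \<longleftrightarrow>
     (\<forall>X\<in>vector_fields A. \<forall>Y\<in>vector_fields A. D X Y \<in> vector_fields A) \<and>
     (\<forall>X\<in>vector_fields A. \<forall>Y\<in>vector_fields A. \<forall>Z\<in>vector_fields A.
        D (X + Y) Z = D X Z + D Y Z \<and> D X (Y + Z) = D X Y + D X Z) \<and>
     (\<forall>f\<in>smooth_functions A. \<forall>X\<in>vector_fields A. \<forall>Y\<in>vector_fields A.
        D (fscale f X) Y = fscale f (D X Y) \<and>
        D X (fscale f Y) = fscale (vderiv X f) Y + fscale f (D X Y))"

definition torsion_free ::
    "('m::{t2_space,second_countable_topology}, 'e::real_normed_vector) atlas \<Rightarrow> 'm connection \<Rightarrow> bool" where
  "torsion_free A D \<longleftrightarrow>
     (\<forall>X\<in>vector_fields A. \<forall>Y\<in>vector_fields A. D X Y - D Y X - lie_bracket X Y = 0)"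

definition cov_deriv_endo :: "'m connection \<Rightarrow> 'm endo_field \<Rightarrow> 'm vfield \<Rightarrow> 'm vfield \<Rightarrow> 'm vfield" where
  "cov_deriv_endo D K X Y = D X (eapply K Y) - eapply K (D X Y)"

definition cov_deriv_bilin ::
    "'m connection \<Rightarrow> 'm bilin_field \<Rightarrow> 'm vfield \<Rightarrow> 'm vfield \<Rightarrow> 'm vfield \<Rightarrow> 'm \<Rightarrow> real" where
  "cov_deriv_bilin D g X Y Z = vderiv X (bapply g Y Z) - bapply g (D X Y) Z - bapply g Y (D X Z)"

definition parallel_endo ::
    "('m::{t2_space,second_countable_topology}, 'e::real_normed_vector) atlas
      \<Rightarrow> 'm connection \<Rightarrow> 'm endo_field \<Rightarrow> bool" where
  "parallel_endo A D K \<longleftrightarrow> (\<forall>X\<in>vector_fields A. \<forall>Y\<in>vector_fields A. cov_deriv_endo D K X Y = 0)"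

definition Codazzi_coupled ::
    "('m::{t2_space,second_countable_topology}, 'e::real_normed_vector) atlas
      \<Rightarrow> 'm connection \<Rightarrow> 'm bilin_field \<Rightarrow> bool" where
  "Codazzi_coupled A D g \<longleftrightarrow>
     (\<forall>X\<in>vector_fields A. \<forall>Y\<in>vector_fields A. \<forall>Z\<in>vector_fields A.
        cov_deriv_bilin D g X Y Z = cov_deriv_bilin D g Z X Y)"

section \<open>The operator \<open>\<Phi>\<close>\<close>

definition lie_deriv_endo :: "'m vfield \<Rightarrow> 'm endo_field \<Rightarrow> 'm vfield \<Rightarrow> 'm vfield" where
  "lie_deriv_endo X K Y = lie_bracket X (eapply K Y) - eapply K (lie_bracket X Y)"

definition Phi ::
    "'m endo_field \<Rightarrow> 'm bilin_field \<Rightarrow> 'm vfield \<Rightarrow> 'm vfield \<Rightarrow> 'm vfield \<Rightarrow> 'm \<Rightarrow> real" where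
  "Phi K g X Y Z =
     vderiv (eapply K X) (bapply g Y Z) - vderiv X (bapply g (eapply K Y) Z)
     + bapply g (lie_deriv_endo Y K X) Z + bapply g Y (lie_deriv_endo Z K X)"

end

theory Submission
  imports Defs
begin

text \<open>
  Write \<open>C(X,Y,Z)\<close> for \<open>(\<nabla>\<^sub>X g)(Y,Z)\<close>.  Torsion-freeness turns Lie brackets into differences of
  covariant derivatives, so for a parallel \<open>K\<close> the Lie derivative \<open>(L\<^sub>Y K)X\<close> becomes
  \<open>K \<nabla>\<^sub>X Y - \<nabla>\<^bsub>KX\<^esub> Y\<close>.  Substituting this in the definition of \<open>\<Phi>\<close> gives
  \<open>(\<Phi>\<^sub>K g)(X,Y,Z) = C(KX,Y,Z) - C(X,KY,Z) - g(KY, \<nabla>\<^sub>X Z) + g(Y, K \<nabla>\<^sub>X Z)\<close>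
  (lemma \<open>Phi_parallel\<close>).  When \<open>\<Phi>\<close> is summed over \<open>K = J\<close> and \<open>K = J\<^sup>*\<close>, the terms without a
  derivative of \<open>g\<close> cancel because \<open>J\<close> and \<open>J\<^sup>*\<close> are adjoint to each other.

  What remains is \<open>C(JX,Y,Z) + C(J\<^sup>*X,Y,Z) - C(X,JY,Z) - C(X,J\<^sup>*Y,Z)\<close>.  The Codazzi condition makes
  \<open>C\<close> cyclically symmetric, and differentiating \<open>g(JX,Y) = g(X,J\<^sup>*Y)\<close> with \<open>J\<close> and \<open>J\<^sup>*\<close> parallel
  shows that they are also adjoint with respect to every \<open>\<nabla>\<^sub>Z g\<close>.  Rotating \<open>Z\<close> into the slot of the
  direction of differentiation, moving the endomorphism across and rotating back gives \<open>C(JX,Y,Z) = C(X,J\<^sup>*Y,Z)\<close> and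
  \<open>C(J\<^sup>*X,Y,Z) = C(X,JY,Z)\<close> (lemma \<open>Codazzi_adjoint_swap\<close>), so the four terms cancel in pairs.
\<close>

lemma tangent_space_diff:
  assumes "u \<in> tangent_space A x" "v \<in> tangent_space A x"
  shows "u - v \<in> tangent_space A x"
  using assms by (simp add: tangent_space_def algebra_simps)

lemma vector_field_tangent:
  "X \<in> vector_fields A \<Longrightarrow> X x \<in> tangent_space A x"
  by (simp add: vector_fields_def)

lemma eapply_vector_field:
  "tensor_field_1_1 A K \<Longrightarrow> X \<in> vector_fields A \<Longrightarrow> eapply K X \<in> vector_fields A"
  by (simp add: tensor_field_1_1_def)

text \<open>
  Additivity is applied to \<open>(u - v) + v\<close>, which yields subtractivity without passing through
  multiplication by \<open>-1\<close>.  The same device serves for bilinear forms.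
\<close>

lemma tensor_field_1_1_diff:
  assumes K: "tensor_field_1_1 A K"
    and u: "u \<in> tangent_space A x" and v: "v \<in> tangent_space A x"
  shows "K x (u - v) = K x u - K x v"
proof -
  have "K x ((u - v) + v) = K x (u - v) + K x v"
    using K tangent_space_diff[OF u v] v by (simp only: tensor_field_1_1_def)
  then show ?thesis by simp
qed

lemma tensor_field_0_2_diff:
  assumes g: "tensor_field_0_2 A g"
    and u: "u \<in> tangent_space A x" and v: "v \<in> tangent_space A x" and w: "w \<in> tangent_space A x"
  shows "g x (u - v) w = g x u w - g x v w" and "g x w (u - v) = g x w u - g x w v"
proof -
  note uv = tangent_space_diff[OF u v]
  have "g x ((u - v) + v) w = g x (u - v) w + g x v w"
    using g uv v w unfolding tensor_field_0_2_def by blast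
  then show "g x (u - v) w = g x u w - g x v w" by simp
  have "g x w ((u - v) + v) = g x w (u - v) + g x w v"
    using g uv v w unfolding tensor_field_0_2_def by blast
  then show "g x w (u - v) = g x w u - g x w v" by simp
qed

lemma bapply_diff:
  assumes "tensor_field_0_2 A g"
    and "U \<in> vector_fields A" "V \<in> vector_fields A" "W \<in> vector_fields A"
  shows "bapply g (U - V) W = bapply g U W - bapply g V W"
    and "bapply g W (U - V) = bapply g W U - bapply g W V"
  using assms by (simp_all add: bapply_def fun_eq_iff tensor_field_0_2_diff vector_field_tangent)

lemma linear_connection_closed:
  "linear_connection A D \<Longrightarrow> X \<in> vector_fields A \<Longrightarrow> Y \<in> vector_fields A
    \<Longrightarrow> D X Y \<in> vector_fields A"
  by (simp add: linear_connection_def)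

lemma parallel_endo_commute:
  "parallel_endo A D K \<Longrightarrow> X \<in> vector_fields A \<Longrightarrow> Y \<in> vector_fields A
    \<Longrightarrow> D X (eapply K Y) = eapply K (D X Y)"
  by (simp add: parallel_endo_def cov_deriv_endo_def)

lemma torsion_free_lie_bracket:
  "torsion_free A D \<Longrightarrow> X \<in> vector_fields A \<Longrightarrow> Y \<in> vector_fields A
    \<Longrightarrow> lie_bracket X Y = D X Y - D Y X"
  by (simp add: torsion_free_def)

text \<open>
  Of the four covariant derivatives that replace the two brackets, the two along \<open>Y\<close> cancel because
  \<open>K\<close> commutes with \<open>\<nabla>\<^sub>Y\<close>.
\<close>

lemma lie_deriv_endo_parallel:
  assumes D: "linear_connection A D" and T: "torsion_free A D"
    and K: "tensor_field_1_1 A K" and P: "parallel_endo A D K"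
    and X: "X \<in> vector_fields A" and Y: "Y \<in> vector_fields A"
  shows "lie_deriv_endo Y K X = eapply K (D X Y) - D (eapply K X) Y"
proof -
  have "eapply K (D Y X - D X Y) = eapply K (D Y X) - eapply K (D X Y)"
    by (simp add: fun_eq_iff eapply_def tensor_field_1_1_diff[OF K] vector_field_tangent
        linear_connection_closed[OF D] X Y)
  then show ?thesis
    by (simp add: lie_deriv_endo_def torsion_free_lie_bracket[OF T] X Y eapply_vector_field[OF K]
        parallel_endo_commute[OF P])
qed

text \<open>
  The derivatives of \<open>g\<close> in \<open>\<Phi>\<close> assemble into covariant ones; the last two terms are the defect
  of \<open>K\<close> from being self-adjoint, which changes sign when \<open>K\<close> is replaced by its adjoint.
\<close>

lemma Phi_parallel:
  assumes D: "linear_connection A D" and T: "torsion_free A D"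
    and K: "tensor_field_1_1 A K" and P: "parallel_endo A D K" and g: "tensor_field_0_2 A g"
    and X: "X \<in> vector_fields A" and Y: "Y \<in> vector_fields A" and Z: "Z \<in> vector_fields A"
  shows "Phi K g X Y Z =
    cov_deriv_bilin D g (eapply K X) Y Z - cov_deriv_bilin D g X (eapply K Y) Z
    - bapply g (eapply K Y) (D X Z) + bapply g Y (eapply K (D X Z))"
  by (simp add: Phi_def cov_deriv_bilin_def lie_deriv_endo_parallel[OF D T K P]
      parallel_endo_commute[OF P] bapply_diff[OF g] eapply_vector_field[OF K]
      linear_connection_closed[OF D] X Y Z)

lemma cov_deriv_bilin_adjoint:
  assumes D: "linear_connection A D"
    and K: "parallel_endo A D K" and L: "parallel_endo A D L"
    and adj: "\<And>U V. U \<in> vector_fields A \<Longrightarrow> V \<in> vector_fields A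
                \<Longrightarrow> bapply g (eapply K U) V = bapply g U (eapply L V)"
    and X: "X \<in> vector_fields A" and Y: "Y \<in> vector_fields A" and Z: "Z \<in> vector_fields A"
  shows "cov_deriv_bilin D g Z (eapply K X) Y = cov_deriv_bilin D g Z X (eapply L Y)"
  by (simp add: cov_deriv_bilin_def adj parallel_endo_commute[OF K] parallel_endo_commute[OF L]
      linear_connection_closed[OF D] X Y Z)

lemma Codazzi_adjoint_swap:
  assumes D: "linear_connection A D" and C: "Codazzi_coupled A D g"
    and K: "tensor_field_1_1 A K" "parallel_endo A D K"
    and L: "tensor_field_1_1 A L" "parallel_endo A D L"
    and adj: "\<And>U V. U \<in> vector_fields A \<Longrightarrow> V \<in> vector_fields A
                \<Longrightarrow> bapply g (eapply K U) V = bapply g U (eapply L V)"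
    and X: "X \<in> vector_fields A" and Y: "Y \<in> vector_fields A" and Z: "Z \<in> vector_fields A"
  shows "cov_deriv_bilin D g (eapply K X) Y Z = cov_deriv_bilin D g X (eapply L Y) Z"
proof -
  have rotate: "cov_deriv_bilin D g U V W = cov_deriv_bilin D g W U V"
    if "U \<in> vector_fields A" "V \<in> vector_fields A" "W \<in> vector_fields A" for U V W
    using C that by (simp add: Codazzi_coupled_def)
  note KX = eapply_vector_field[OF K(1) X] and LY = eapply_vector_field[OF L(1) Y]
  have "cov_deriv_bilin D g (eapply K X) Y Z = cov_deriv_bilin D g Z (eapply K X) Y"
    by (rule rotate[OF KX Y Z])
  also have "\<dots> = cov_deriv_bilin D g Z X (eapply L Y)"
    by (rule cov_deriv_bilin_adjoint[OF D K(2) L(2) adj X Y Z])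
  also have "\<dots> = cov_deriv_bilin D g X (eapply L Y) Z"
    by (rule rotate[OF X LY Z, symmetric])
  finally show ?thesis .
qed

theorem theorem2:
  fixes A :: "('m::{t2_space,second_countable_topology}, 'e::real_normed_vector) atlas"
    and J Js :: "'m endo_field" and g :: "'m bilin_field" and D :: "'m connection"
    and X Y Z :: "'m vfield"
  assumes "metallic_like_pseudo_Riemannian_manifold A J Js g"
    and "linear_connection A D"
    and "torsion_free A D"
    and "parallel_endo A D J"
    and "parallel_endo A D Js"
    and "Codazzi_coupled A D g"
    and "X \<in> vector_fields A" and "Y \<in> vector_fields A" and "Z \<in> vector_fields A"
  shows "Phi Js g X Y Z + Phi J g X Y Z = 0"
proof -
  note D = assms(2) and T = assms(3) and PJ = assms(4) and PJs = assms(5) and C = assms(6)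
    and X = assms(7) and Y = assms(8) and Z = assms(9)
  have g: "tensor_field_0_2 A g"
    and sym: "\<And>x u v. u \<in> tangent_space A x \<Longrightarrow> v \<in> tangent_space A x \<Longrightarrow> g x u v = g x v u"
    and J: "tensor_field_1_1 A J" and Js: "tensor_field_1_1 A Js"
    and adj: "\<And>U V. U \<in> vector_fields A \<Longrightarrow> V \<in> vector_fields A
                \<Longrightarrow> bapply g (eapply J U) V = bapply g U (eapply Js V)"
    using assms(1)
    by (simp_all add: metallic_like_pseudo_Riemannian_manifold_def pseudo_Riemannian_metric_def
        metallic_structure_def bundle_isomorphism_def)
  have bsym: "bapply g U V = bapply g V U"
    if "U \<in> vector_fields A" "V \<in> vector_fields A" for U V
    using that by (simp add: bapply_def fun_eq_iff sym vector_field_tangent)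
  have adj': "bapply g (eapply Js U) V = bapply g U (eapply J V)"
    if "U \<in> vector_fields A" "V \<in> vector_fields A" for U V
    using that by (metis adj bsym eapply_vector_field J Js)
  have DXZ: "D X Z \<in> vector_fields A"
    by (rule linear_connection_closed[OF D X Z])
  show ?thesis
    by (simp add: Phi_parallel[OF D T J PJ g X Y Z] Phi_parallel[OF D T Js PJs g X Y Z]
        Codazzi_adjoint_swap[OF D C J PJ Js PJs adj X Y Z]
        Codazzi_adjoint_swap[OF D C Js PJs J PJ adj' X Y Z]
        adj[OF Y DXZ] adj'[OF Y DXZ])
qed

end
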